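(* Let $n\ge 1$ and let $V$ be the $k$-vector space freely generated by the vertices $v_1,\dots,v_n$ of the $(n,1)$-De Bruijn graph. Then the Markovian coproducts $\Delta_M,\tilde\Delta_M:V\to V^{\otimes 2}$ defined by $$\Delta_M v_i=v_i\otimes\sum_{j=1}^n v_j,\qquad \tilde\Delta_M v_i=\sum_{j=1}^n v_j\otimes v_i$$ define a coassociative co-dialgebra $(V,\Delta_M,\tilde\Delta_M)$.
   Context: The field $k$ is $\mathbb{R}$ or $\mathbb{C}$. The $(n,1)$-De Bruijn graph is the directed graph with $n$ vertices, with exactly one arrow from $u$ to $v$ for every ordered pair of vertices $(u,v)$ (including loops). A coassociative co-dialgebra is a $k$-vector space $D$ with two linear maps $\Delta,\tilde\Delta:D\to D^{\otimes 2}$ such that: (1) $\Delta$ and $\tilde\Delta$ are coassociative; (2) $(id\otimes\Delta)\Delta=(id\otimes\tilde\Delta)\Delta$; (3) $(\tilde\Delta\otimes id)\tilde\Delta=(\Delta\otimes id)\tilde\Delta$; (4) $(\tilde\Delta\otimes id)\Delta=(id\otimes\Delta)\tilde\Delta$. Counits are optional. *)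

theory Defs
  imports "HOL-Algebra.AbelCoset" "Jordan_Normal_Form.VS_Connect" "Graph_Theory.Digraph"
begin

text \<open>
  Vector spaces are modules over a field in the sense of \<open>HOL-Algebra\<close> (locale
  \<open>vectorspace\<close>).  The ring fields \<open>mult\<close> and \<open>one\<close> of a \<open>module\<close> record play no
  role and are left undefined.
\<close>

section \<open>Free vector spaces\<close>

text \<open>Formal linear combinations of elements of \<open>S\<close>, as finitely supported coefficient functions.\<close>

definition free_space :: "('k, 'm) ring_scheme \<Rightarrow> 'b set \<Rightarrow> ('k, 'b \<Rightarrow> 'k) module" where
  "free_space K S =
    \<lparr> carrier = {f. range f \<subseteq> carrier K \<and> finite {x. f x \<noteq> \<zero>\<^bsub>K\<^esub>} \<and> {x. f x \<noteq> \<zero>\<^bsub>K\<^esub>} \<subseteq> S},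
      mult = undefined, one = undefined,
      zero = (\<lambda>x. \<zero>\<^bsub>K\<^esub>), add = (\<lambda>f g x. f x \<oplus>\<^bsub>K\<^esub> g x),
      smult = (\<lambda>a f x. a \<otimes>\<^bsub>K\<^esub> f x) \<rparr>"

definition free_gen :: "('k, 'm) ring_scheme \<Rightarrow> 'b \<Rightarrow> 'b \<Rightarrow> 'k" where
  "free_gen K s = (\<lambda>x. if x = s then \<one>\<^bsub>K\<^esub> else \<zero>\<^bsub>K\<^esub>)"

text \<open>
  The linear map from a free space to \<open>M\<close> that takes the prescribed value \<open>\<phi> s\<close> on each generator
  \<open>free_gen K s\<close>.
\<close>

definition lin_extend ::
  "('k, 'm) ring_scheme \<Rightarrow> ('k, 'c, 'n) module_scheme \<Rightarrow> ('b \<Rightarrow> 'c) \<Rightarrow> ('b \<Rightarrow> 'k) \<Rightarrow> 'c" where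
  "lin_extend K M \<phi> f = (\<Oplus>\<^bsub>M\<^esub> x \<in> {x. f x \<noteq> \<zero>\<^bsub>K\<^esub>}. f x \<odot>\<^bsub>M\<^esub> \<phi> x)"


section \<open>Tensor products\<close>

definition quotient_space :: "('k, 'b, 'n) module_scheme \<Rightarrow> 'b set \<Rightarrow> ('k, 'b set) module" where
  "quotient_space M N =
    \<lparr> carrier = a_rcosets\<^bsub>M\<^esub> N,
      mult = undefined, one = undefined,
      zero = N, add = (\<lambda>X Y. X <+>\<^bsub>M\<^esub> Y),
      smult = (\<lambda>a X. \<Union>x\<in>X. N +>\<^bsub>M\<^esub> (a \<odot>\<^bsub>M\<^esub> x)) \<rparr>"

text \<open>
  The tensor product of \<open>V\<close> and \<open>W\<close> is the free space on \<open>V \<times> W\<close> modulo the span of the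
  bilinearity relations.
\<close>

definition tensor_rels ::
  "('k, 'm) ring_scheme \<Rightarrow> ('k, 'v, 'n) module_scheme \<Rightarrow> ('k, 'w, 'o) module_scheme
    \<Rightarrow> ('v \<times> 'w \<Rightarrow> 'k) set" where
  "tensor_rels K V W =
    (let F = free_space K (carrier V \<times> carrier W); g = (\<lambda>v w. free_gen K (v, w)) in
      {g (v \<oplus>\<^bsub>V\<^esub> v') w \<ominus>\<^bsub>F\<^esub> (g v w \<oplus>\<^bsub>F\<^esub> g v' w) | v v' w.
          v \<in> carrier V \<and> v' \<in> carrier V \<and> w \<in> carrier W} \<union>
      {g v (w \<oplus>\<^bsub>W\<^esub> w') \<ominus>\<^bsub>F\<^esub> (g v w \<oplus>\<^bsub>F\<^esub> g v w') | v w w'.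
          v \<in> carrier V \<and> w \<in> carrier W \<and> w' \<in> carrier W} \<union>
      {g (a \<odot>\<^bsub>V\<^esub> v) w \<ominus>\<^bsub>F\<^esub> a \<odot>\<^bsub>F\<^esub> g v w | a v w.
          a \<in> carrier K \<and> v \<in> carrier V \<and> w \<in> carrier W} \<union>
      {g v (a \<odot>\<^bsub>W\<^esub> w) \<ominus>\<^bsub>F\<^esub> a \<odot>\<^bsub>F\<^esub> g v w | a v w.
          a \<in> carrier K \<and> v \<in> carrier V \<and> w \<in> carrier W})"

definition tensor_null ::
  "('k, 'm) ring_scheme \<Rightarrow> ('k, 'v, 'n) module_scheme \<Rightarrow> ('k, 'w, 'o) module_scheme
    \<Rightarrow> ('v \<times> 'w \<Rightarrow> 'k) set" where
  "tensor_null K V W =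
    LinearCombinations.module.span K (free_space K (carrier V \<times> carrier W)) (tensor_rels K V W)"

definition tensor_space ::
  "('k, 'm) ring_scheme \<Rightarrow> ('k, 'v, 'n) module_scheme \<Rightarrow> ('k, 'w, 'o) module_scheme
    \<Rightarrow> ('k, ('v \<times> 'w \<Rightarrow> 'k) set) module" where
  "tensor_space K V W =
    quotient_space (free_space K (carrier V \<times> carrier W)) (tensor_null K V W)"

definition pure_tensor ::
  "('k, 'm) ring_scheme \<Rightarrow> ('k, 'v, 'n) module_scheme \<Rightarrow> ('k, 'w, 'o) module_scheme
    \<Rightarrow> 'v \<Rightarrow> 'w \<Rightarrow> ('v \<times> 'w \<Rightarrow> 'k) set" where
  "pure_tensor K V W v w =
    tensor_null K V W +>\<^bsub>free_space K (carrier V \<times> carrier W)\<^esub> free_gen K (v, w)"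

text \<open>
  The linear map out of a tensor product induced by a bilinear map \<open>\<phi>\<close>: for bilinear \<open>\<phi>\<close> its linear
  extension is constant on each coset \<open>X\<close>, so the image of \<open>X\<close> is a singleton.
\<close>

definition tensor_lift ::
  "('k, 'm) ring_scheme \<Rightarrow> ('k, 'c, 'n) module_scheme \<Rightarrow> ('v \<Rightarrow> 'w \<Rightarrow> 'c)
    \<Rightarrow> ('v \<times> 'w \<Rightarrow> 'k) set \<Rightarrow> 'c" where
  "tensor_lift K M \<phi> X = the_elem (lin_extend K M (\<lambda>(v, w). \<phi> v w) ` X)"

text \<open>
  The map \<open>f \<otimes> g\<close> into the tensor product of \<open>V'\<close> and \<open>W'\<close>.
\<close>

definition tensor_map ::
  "('k, 'm) ring_scheme \<Rightarrow> ('k, 'v2, 'n) module_scheme \<Rightarrow> ('k, 'w2, 'o) module_scheme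
    \<Rightarrow> ('v \<Rightarrow> 'v2) \<Rightarrow> ('w \<Rightarrow> 'w2) \<Rightarrow> ('v \<times> 'w \<Rightarrow> 'k) set \<Rightarrow> ('v2 \<times> 'w2 \<Rightarrow> 'k) set" where
  "tensor_map K V' W' f g =
    tensor_lift K (tensor_space K V' W') (\<lambda>v w. pure_tensor K V' W' (f v) (g w))"

text \<open>
  The canonical isomorphism \<open>(U \<otimes> V) \<otimes> W \<rightarrow> U \<otimes> (V \<otimes> W)\<close>, \<open>(u \<otimes> v) \<otimes> w \<mapsto> u \<otimes> (v \<otimes> w)\<close>.
\<close>

definition tensor_assoc ::
  "('k, 'm) ring_scheme \<Rightarrow> ('k, 'u, 'l) module_scheme \<Rightarrow> ('k, 'v, 'n) module_scheme
    \<Rightarrow> ('k, 'w, 'o) module_scheme \<Rightarrow> (('u \<times> 'v \<Rightarrow> 'k) set \<times> 'w \<Rightarrow> 'k) set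
    \<Rightarrow> ('u \<times> ('v \<times> 'w \<Rightarrow> 'k) set \<Rightarrow> 'k) set" where
  "tensor_assoc K U V W =
    (let T = tensor_space K U (tensor_space K V W) in
      tensor_lift K T (\<lambda>t w. tensor_lift K T
        (\<lambda>u v. pure_tensor K U (tensor_space K V W) u (pure_tensor K V W v w)) t))"


section \<open>Coassociative co-dialgebras\<close>

text \<open>
  \<open>tensor_left f\<close> is \<open>f \<otimes> id : D \<otimes> D \<rightarrow> (D \<otimes> D) \<otimes> D\<close> and \<open>tensor_right f\<close> is
  \<open>id \<otimes> f : D \<otimes> D \<rightarrow> D \<otimes> (D \<otimes> D)\<close>, for \<open>f : D \<rightarrow> D \<otimes> D\<close>.
\<close>

definition tensor_left ::
  "('k, 'm) ring_scheme \<Rightarrow> ('k, 'd, 'n) module_scheme \<Rightarrow> ('d \<Rightarrow> ('d \<times> 'd \<Rightarrow> 'k) set)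
    \<Rightarrow> ('d \<times> 'd \<Rightarrow> 'k) set \<Rightarrow> (('d \<times> 'd \<Rightarrow> 'k) set \<times> 'd \<Rightarrow> 'k) set" where
  "tensor_left K D f = tensor_map K (tensor_space K D D) D f id"

definition tensor_right ::
  "('k, 'm) ring_scheme \<Rightarrow> ('k, 'd, 'n) module_scheme \<Rightarrow> ('d \<Rightarrow> ('d \<times> 'd \<Rightarrow> 'k) set)
    \<Rightarrow> ('d \<times> 'd \<Rightarrow> 'k) set \<Rightarrow> ('d \<times> ('d \<times> 'd \<Rightarrow> 'k) set \<Rightarrow> 'k) set" where
  "tensor_right K D f = tensor_map K D (tensor_space K D D) id f"

definition coassociative ::
  "('k, 'm) ring_scheme \<Rightarrow> ('k, 'd, 'n) module_scheme \<Rightarrow> ('d \<Rightarrow> ('d \<times> 'd \<Rightarrow> 'k) set) \<Rightarrow> bool" where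
  "coassociative K D \<Delta> \<longleftrightarrow>
    (\<forall>x\<in>carrier D. tensor_assoc K D D D (tensor_left K D \<Delta> (\<Delta> x)) = tensor_right K D \<Delta> (\<Delta> x))"

text \<open>
  In the literature \<open>(D \<otimes> D) \<otimes> D\<close> and \<open>D \<otimes> (D \<otimes> D)\<close> are identified tacitly; here
  \<open>tensor_assoc\<close> mediates wherever the two sides of an axiom live in different ones.
\<close>

locale coassociative_codialgebra = vectorspace K D
  for K :: "('k, 'm) ring_scheme" and D :: "('k, 'd, 'n) module_scheme" +
  fixes \<Delta> \<Delta>' :: "'d \<Rightarrow> ('d \<times> 'd \<Rightarrow> 'k) set"
  assumes linear_left: "linear_map K D (tensor_space K D D) \<Delta>"
    and linear_right: "linear_map K D (tensor_space K D D) \<Delta>'"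
    and coassoc_left: "coassociative K D \<Delta>"
    and coassoc_right: "coassociative K D \<Delta>'"
    and left_inner: "x \<in> carrier D \<Longrightarrow>
      tensor_right K D \<Delta> (\<Delta> x) = tensor_right K D \<Delta>' (\<Delta> x)"
    and right_inner: "x \<in> carrier D \<Longrightarrow>
      tensor_left K D \<Delta>' (\<Delta>' x) = tensor_left K D \<Delta> (\<Delta>' x)"
    and mixed: "x \<in> carrier D \<Longrightarrow>
      tensor_assoc K D D D (tensor_left K D \<Delta>' (\<Delta> x)) = tensor_right K D \<Delta> (\<Delta>' x)"


section \<open>The De Bruijn graph and its Markovian coproducts\<close>

text \<open>The \<open>(n,1)\<close>-De Bruijn graph; the vertex \<open>v\<^sub>i\<close> is the number \<open>i\<close>.\<close>

definition de_bruijn_graph :: "nat \<Rightarrow> (nat, nat \<times> nat) pre_digraph" where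
  "de_bruijn_graph n =
    \<lparr> verts = {1..n}, arcs = {1..n} \<times> {1..n}, tail = fst, head = snd \<rparr>"

definition de_bruijn_space :: "('k, 'm) ring_scheme \<Rightarrow> nat \<Rightarrow> ('k, nat \<Rightarrow> 'k) module" where
  "de_bruijn_space K n = free_space K (verts (de_bruijn_graph n))"

definition markov_coproduct ::
  "('k, 'm) ring_scheme \<Rightarrow> nat \<Rightarrow> (nat \<Rightarrow> 'k) \<Rightarrow> ((nat \<Rightarrow> 'k) \<times> (nat \<Rightarrow> 'k) \<Rightarrow> 'k) set" where
  "markov_coproduct K n =
    (let V = de_bruijn_space K n in
      lin_extend K (tensor_space K V V)
        (\<lambda>i. pure_tensor K V V (free_gen K i) (\<Oplus>\<^bsub>V\<^esub> j \<in> {1..n}. free_gen K j)))"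

definition markov_coproduct' ::
  "('k, 'm) ring_scheme \<Rightarrow> nat \<Rightarrow> (nat \<Rightarrow> 'k) \<Rightarrow> ((nat \<Rightarrow> 'k) \<times> (nat \<Rightarrow> 'k) \<Rightarrow> 'k) set" where
  "markov_coproduct' K n =
    (let V = de_bruijn_space K n in
      lin_extend K (tensor_space K V V)
        (\<lambda>i. \<Oplus>\<^bsub>tensor_space K V V\<^esub> j \<in> {1..n}. pure_tensor K V V (free_gen K j) (free_gen K i)))"

end

theory Submission
  imports Defs
begin

text \<open>
  Put \<open>s = v\<^sub>1 + \<dots> + v\<^sub>n\<close>.  On generators, and hence by linearity on all of \<open>V\<close>, the two Markovian
  coproducts are \<open>\<Delta> x = x \<otimes> s\<close> and \<open>\<Delta>' x = s \<otimes> x\<close>: tensoring with one fixed vector on the right or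
  on the left.  For any vector \<open>s\<close> of any vector space these two maps satisfy the axioms of a
  co-dialgebra.  All iterated coproducts are then pure tensors, and each axiom compares two equal ones:
  \<open>(\<Delta> \<otimes> id) \<Delta> x = (id \<otimes> \<Delta>) \<Delta> x = (id \<otimes> \<Delta>') \<Delta> x = x \<otimes> s \<otimes> s\<close>, because \<open>\<Delta> s = \<Delta>' s = s \<otimes> s\<close>;
  symmetrically, \<open>s \<otimes> s \<otimes> x\<close> is the value of both composites of \<open>\<Delta>'\<close> with itself and of
  \<open>(\<Delta> \<otimes> id) \<Delta>'\<close>; and the mixed axiom reads \<open>(s \<otimes> x) \<otimes> s = s \<otimes> (x \<otimes> s)\<close>.  This is
  \<open>codialgebra_of_vector\<close>; the identification of the Markovian coproducts is
  \<open>de_bruijn_codialgebra\<close>, for an arbitrary field.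

  What remains is to know how induced maps act on pure tensors, that is, the universal properties of
  the constructions involved: a map on generators extends linearly to a free module
  (\<open>lin_extend_hom\<close>, \<open>free_space_hom_eqI\<close>), and a bilinear map kills the relations
  defining the tensor product, so that it descends to the quotient (\<open>tensor_lift_hom\<close>,
  \<open>tensor_lift_pure\<close>).  The values of \<open>f \<otimes> g\<close> and of the associator on pure tensors
  (\<open>tensor_map_pure\<close>, \<open>tensor_assoc_pure\<close>) are instances of the latter.
\<close>

(* Modules and their homomorphisms are those relative to a carrier, not the type-class based ones. *)
hide_const (open) Modules.module Modules.module_hom
hide_fact (open) Modules.module_hom_def

section \<open>Free modules\<close>

lemma free_space_simps [simp]:
  "f \<in> carrier (free_space K S) \<longleftrightarrow>
     range f \<subseteq> carrier K \<and> finite {x. f x \<noteq> \<zero>\<^bsub>K\<^esub>} \<and> {x. f x \<noteq> \<zero>\<^bsub>K\<^esub>} \<subseteq> S"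
  "\<zero>\<^bsub>free_space K S\<^esub> = (\<lambda>x. \<zero>\<^bsub>K\<^esub>)"
  "f \<oplus>\<^bsub>free_space K S\<^esub> g = (\<lambda>x. f x \<oplus>\<^bsub>K\<^esub> g x)"
  "a \<odot>\<^bsub>free_space K S\<^esub> f = (\<lambda>x. a \<otimes>\<^bsub>K\<^esub> f x)"
  by (auto simp: free_space_def)

lemma (in cring) free_space_add_closed:
  assumes "f \<in> carrier (free_space R S)" "g \<in> carrier (free_space R S)"
  shows "(\<lambda>x. f x \<oplus> g x) \<in> carrier (free_space R S)"
proof -
  have "{x. f x \<oplus> g x \<noteq> \<zero>} \<subseteq> {x. f x \<noteq> \<zero>} \<union> {x. g x \<noteq> \<zero>}"
    by auto
  moreover have "finite ({x. f x \<noteq> \<zero>} \<union> {x. g x \<noteq> \<zero>})"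
    using assms by simp
  ultimately have "finite {x. f x \<oplus> g x \<noteq> \<zero>}"
    by (rule finite_subset)
  with assms \<open>{x. f x \<oplus> g x \<noteq> \<zero>} \<subseteq> _\<close> show ?thesis
    by (simp add: image_subset_iff) blast
qed

lemma (in cring) free_space_smult_closed:
  assumes "a \<in> carrier R" "f \<in> carrier (free_space R S)"
  shows "(\<lambda>x. a \<otimes> f x) \<in> carrier (free_space R S)"
proof -
  have "{x. a \<otimes> f x \<noteq> \<zero>} \<subseteq> {x. f x \<noteq> \<zero>}"
    using assms by auto
  moreover from assms have "finite {x. f x \<noteq> \<zero>}"
    by simp
  ultimately have "finite {x. a \<otimes> f x \<noteq> \<zero>}"
    by (rule finite_subset)
  with assms show ?thesis
    by (auto simp: image_subset_iff)
qed

lemma (in cring) free_space_module: "module R (free_space R S)"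
proof (rule module_criteria)
  show "\<forall>v\<in>carrier (free_space R S). \<exists>w\<in>carrier (free_space R S).
      v \<oplus>\<^bsub>free_space R S\<^esub> w = \<zero>\<^bsub>free_space R S\<^esub>"
  proof
    fix v
    assume v: "v \<in> carrier (free_space R S)"
    show "\<exists>w\<in>carrier (free_space R S). v \<oplus>\<^bsub>free_space R S\<^esub> w = \<zero>\<^bsub>free_space R S\<^esub>"
    proof
      show "(\<lambda>x. \<ominus> \<one> \<otimes> v x) \<in> carrier (free_space R S)"
        using v by (intro free_space_smult_closed) auto
      show "v \<oplus>\<^bsub>free_space R S\<^esub> (\<lambda>x. \<ominus> \<one> \<otimes> v x) = \<zero>\<^bsub>free_space R S\<^esub>"
        using v by (auto simp: image_subset_iff l_minus r_neg)
    qed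
  qed
next
  show "cring R"
    by (rule is_cring)
next
  show "\<forall>v w. v \<in> carrier (free_space R S) \<and> w \<in> carrier (free_space R S) \<longrightarrow>
      v \<oplus>\<^bsub>free_space R S\<^esub> w \<in> carrier (free_space R S)"
    by (auto simp del: free_space_simps(1) intro!: free_space_add_closed)
next
  show "\<forall>c v. c \<in> carrier R \<and> v \<in> carrier (free_space R S) \<longrightarrow>
      c \<odot>\<^bsub>free_space R S\<^esub> v \<in> carrier (free_space R S)"
    by (auto simp del: free_space_simps(1) intro!: free_space_smult_closed)
qed (auto simp: image_subset_iff a_ac m_assoc l_distr r_distr)

lemma (in cring) free_gen_closed: "s \<in> S \<Longrightarrow> free_gen R s \<in> carrier (free_space R S)"
proof -
  have "{x. free_gen R s x \<noteq> \<zero>} \<subseteq> {s}"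
    by (auto simp: free_gen_def)
  moreover from this have "finite {x. free_gen R s x \<noteq> \<zero>}"
    by (rule finite_subset) simp
  ultimately show "s \<in> S \<Longrightarrow> ?thesis"
    by (auto simp: free_gen_def)
qed

lemma module_homI:
  assumes "\<And>x. x \<in> carrier M \<Longrightarrow> f x \<in> carrier N"
    and "\<And>x y. x \<in> carrier M \<Longrightarrow> y \<in> carrier M \<Longrightarrow> f (x \<oplus>\<^bsub>M\<^esub> y) = f x \<oplus>\<^bsub>N\<^esub> f y"
    and "\<And>a x. a \<in> carrier R \<Longrightarrow> x \<in> carrier M \<Longrightarrow> f (a \<odot>\<^bsub>M\<^esub> x) = a \<odot>\<^bsub>N\<^esub> f x"
  shows "f \<in> module_hom R M N"
  using assms by (auto simp: module_hom_def)

lemma module_hom_in_carrier: "f \<in> module_hom R M N \<Longrightarrow> x \<in> carrier M \<Longrightarrow> f x \<in> carrier N"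
  using module_hom_closed by blast

lemma module_hom_id: "id \<in> module_hom R M M"
  by (rule module_homI) auto

lemma module_hom_comp:
  "f \<in> module_hom R M N \<Longrightarrow> g \<in> module_hom R N P \<Longrightarrow> (\<lambda>x. g (f x)) \<in> module_hom R M P"
  by (rule module_homI)
    (simp_all add: module_hom_in_carrier[of f R M N] module_hom_in_carrier[of g R N P]
      LinearCombinations.module_hom_add[of f R M N] LinearCombinations.module_hom_add[of g R N P]
      module_hom_smult[of f R M N] module_hom_smult[of g R N P])

lemma module_hom_finsum:
  assumes "Module.module R M" "Module.module R N" "f \<in> module_hom R M N" "g \<in> A \<rightarrow> carrier M"
  shows "f (\<Oplus>\<^bsub>M\<^esub>i\<in>A. g i) = (\<Oplus>\<^bsub>N\<^esub>i\<in>A. f (g i))"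
proof -
  interpret mod_hom R M N f
    using assms by (simp add: mod_hom_def mod_hom_axioms_def)
  from assms(4) show ?thesis
    by (induction A rule: infinite_finite_induct) (auto simp: Pi_iff)
qed

context Module.module
begin

text \<open>
  The sum defining \<open>lin_extend\<close> runs over the support of its argument, which varies from argument to
  argument.  Enlarging it to a common finite set is what makes additivity accessible.
\<close>

lemma lin_extend_eq:
  assumes "finite A" "{x. f x \<noteq> \<zero>} \<subseteq> A" "range f \<subseteq> carrier R" "\<phi> \<in> A \<rightarrow> carrier M"
  shows "lin_extend R M \<phi> f = (\<Oplus>\<^bsub>M\<^esub>x\<in>A. f x \<odot>\<^bsub>M\<^esub> \<phi> x)"
  unfolding lin_extend_def
  using assms by (intro M.add.finprod_mono_neutral_cong_left) (auto simp: Pi_iff image_subset_iff)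

lemma lin_extend_gen:
  assumes "\<phi> s \<in> carrier M"
  shows "lin_extend R M \<phi> (free_gen R s) = \<phi> s"
proof -
  have "lin_extend R M \<phi> (free_gen R s) = (\<Oplus>\<^bsub>M\<^esub>x\<in>{s}. free_gen R s x \<odot>\<^bsub>M\<^esub> \<phi> x)"
    using assms by (intro lin_extend_eq) (auto simp: free_gen_def)
  also have "\<dots> = \<phi> s"
    using assms by (simp add: free_gen_def)
  finally show ?thesis .
qed

lemma lin_extend_hom:
  assumes \<phi>: "\<phi> \<in> S \<rightarrow> carrier M"
  shows "lin_extend R M \<phi> \<in> module_hom R (free_space R S) M"
proof (rule module_homI)
  fix f
  assume f: "f \<in> carrier (free_space R S)"
  let ?A = "{x. f x \<noteq> \<zero>}"
  have f': "f x \<in> carrier R" for x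
    using f by (auto simp: image_subset_iff)
  have A: "finite ?A" "\<phi> \<in> ?A \<rightarrow> carrier M"
    using f \<phi> by auto
  show "lin_extend R M \<phi> f \<in> carrier M"
    using f' A by (auto simp: lin_extend_def intro!: M.finsum_closed)
  show "lin_extend R M \<phi> (a \<odot>\<^bsub>free_space R S\<^esub> f) = a \<odot>\<^bsub>M\<^esub> lin_extend R M \<phi> f"
    if a: "a \<in> carrier R" for a
  proof -
    have "lin_extend R M \<phi> (a \<odot>\<^bsub>free_space R S\<^esub> f) = (\<Oplus>\<^bsub>M\<^esub>x\<in>?A. (a \<otimes> f x) \<odot>\<^bsub>M\<^esub> \<phi> x)"
      using a f' A by (simp, subst lin_extend_eq[of ?A]) auto
    also have "\<dots> = (\<Oplus>\<^bsub>M\<^esub>x\<in>?A. a \<odot>\<^bsub>M\<^esub> (f x \<odot>\<^bsub>M\<^esub> \<phi> x))"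
      using a f' A by (intro M.finsum_cong') (auto simp: smult_assoc1 Pi_iff)
    also have "\<dots> = a \<odot>\<^bsub>M\<^esub> lin_extend R M \<phi> f"
      unfolding lin_extend_def using a f' A by (subst finsum_smult) auto
    finally show ?thesis .
  qed
  fix g
  assume g: "g \<in> carrier (free_space R S)"
  have g': "g x \<in> carrier R" for x
    using g by (auto simp: image_subset_iff)
  let ?B = "?A \<union> {x. g x \<noteq> \<zero>}"
  have B: "finite ?B" "\<phi> \<in> ?B \<rightarrow> carrier M"
    using f g \<phi> by auto
  have "lin_extend R M \<phi> (f \<oplus>\<^bsub>free_space R S\<^esub> g) = (\<Oplus>\<^bsub>M\<^esub>x\<in>?B. (f x \<oplus> g x) \<odot>\<^bsub>M\<^esub> \<phi> x)"
    using f' g' B by (simp, subst lin_extend_eq[of ?B]) auto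
  also have "\<dots> = (\<Oplus>\<^bsub>M\<^esub>x\<in>?B. f x \<odot>\<^bsub>M\<^esub> \<phi> x \<oplus>\<^bsub>M\<^esub> g x \<odot>\<^bsub>M\<^esub> \<phi> x)"
    using f' g' B by (intro M.finsum_cong') (auto simp: smult_l_distr Pi_iff)
  also have "\<dots> = (\<Oplus>\<^bsub>M\<^esub>x\<in>?B. f x \<odot>\<^bsub>M\<^esub> \<phi> x) \<oplus>\<^bsub>M\<^esub> (\<Oplus>\<^bsub>M\<^esub>x\<in>?B. g x \<odot>\<^bsub>M\<^esub> \<phi> x)"
    using f' g' B by (intro M.finsum_addf) (auto simp: Pi_iff)
  also have "\<dots> = lin_extend R M \<phi> f \<oplus>\<^bsub>M\<^esub> lin_extend R M \<phi> g"
    using f' g' B lin_extend_eq[of ?B f \<phi>] lin_extend_eq[of ?B g \<phi>]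
    by (auto simp: image_subset_iff)
  finally show "lin_extend R M \<phi> (f \<oplus>\<^bsub>free_space R S\<^esub> g)
    = lin_extend R M \<phi> f \<oplus>\<^bsub>M\<^esub> lin_extend R M \<phi> g" .
qed

text \<open>
  Every formal linear combination is built from generators by removing one point of its support at a
  time, so a linear map on a free module is determined by its values on the generators.
\<close>

lemma free_space_hom_eqI:
  assumes "h \<in> module_hom R (free_space R S) M" "k \<in> module_hom R (free_space R S) M"
    and gen: "\<And>s. s \<in> S \<Longrightarrow> h (free_gen R s) = k (free_gen R s)"
    and "f \<in> carrier (free_space R S)"
  shows "h f = k f"
proof -
  let ?F = "free_space R S"
  interpret F: Module.module R ?F
    by (rule R.free_space_module)
  interpret h: mod_hom R ?F M h
    using assms(1) by unfold_locales
  interpret k: mod_hom R ?F M k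
    using assms(2) by unfold_locales
  have "h f = k f" if "finite A" "{x. f x \<noteq> \<zero>} \<subseteq> A" "f \<in> carrier ?F" for A f
    using that
  proof (induction A arbitrary: f rule: finite_induct)
    case empty
    then have "f = \<zero>\<^bsub>?F\<^esub>"
      by auto
    then show ?case
      using h.f0_is_0 k.f0_is_0 by metis
  next
    case (insert s A)
    show ?case
    proof (cases "f s = \<zero>")
      case True
      with insert show ?thesis
        by (intro insert.IH) auto
    next
      case False
      with insert.prems have s: "s \<in> S" "f s \<in> carrier R"
        by (auto simp: image_subset_iff)
      \<comment> \<open>Split off the term of \<open>s\<close>; what remains is supported in \<open>A\<close>.\<close>
      let ?g = "f(s := \<zero>)"
      have "{x. ?g x \<noteq> \<zero>} \<subseteq> {x. f x \<noteq> \<zero>}"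
        by auto
      then have "finite {x. ?g x \<noteq> \<zero>}"
        using insert.prems finite_subset by (auto simp del: fun_upd_apply)
      with insert.prems have g: "?g \<in> carrier ?F" "{x. ?g x \<noteq> \<zero>} \<subseteq> A"
        by (auto simp: image_subset_iff)
      have gen_s: "free_gen R s \<in> carrier ?F"
        using s by (intro R.free_gen_closed)
      have "f = f s \<odot>\<^bsub>?F\<^esub> free_gen R s \<oplus>\<^bsub>?F\<^esub> ?g"
        using insert.prems by (auto simp: free_gen_def image_subset_iff)
      moreover have "h ?g = k ?g"
        using g by (intro insert.IH)
      then have "h (f s \<odot>\<^bsub>?F\<^esub> free_gen R s \<oplus>\<^bsub>?F\<^esub> ?g) = k (f s \<odot>\<^bsub>?F\<^esub> free_gen R s \<oplus>\<^bsub>?F\<^esub> ?g)"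
        using gen[OF s(1)] gen_s s g(1) by (simp del: free_space_simps fun_upd_apply)
      ultimately show ?thesis
        by metis
    qed
  qed
  from this[of "{x. f x \<noteq> \<zero>}" f] assms(4) show ?thesis
    by simp
qed

end

(* From here on, elements of free modules are handled through the module laws, not pointwise. *)
declare free_space_simps [simp del]

section \<open>Quotient modules\<close>

context Module.module
begin

lemma submodule_abelian_subgroup:
  assumes "submodule R N M"
  shows "abelian_subgroup N M"
proof -
  interpret N: submodule R N M
    by (rule assms)
  have "\<ominus>\<^bsub>M\<^esub> x \<in> N" if "x \<in> N" for x
  proof -
    from that have "\<ominus> \<one> \<odot>\<^bsub>M\<^esub> x \<in> N" "x \<in> carrier M"
      using N.subset by auto
    then show ?thesis
      by (simp add: smult_minus_1)
  qed
  then have "additive_subgroup N M"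
    using N.subset N.zero_closed
    by (intro additive_subgroup.intro M.add.subgroupI) (auto simp: a_inv_def simp del: N.zero_closed)
  then show ?thesis
    by (rule abelian_subgroupI3) (rule M.abelian_group_axioms)
qed

context
  fixes N
  assumes N: "submodule R N M"
begin

interpretation N: submodule R N M
  by (rule N)

interpretation NA: abelian_subgroup N M
  by (rule submodule_abelian_subgroup[OF N])

text \<open>
  Scalar multiplication on the quotient is defined as a union over the whole coset.  All members of
  that union coincide, because a scalar maps \<open>N\<close> into \<open>N\<close>.
\<close>

lemma coset_smult:
  assumes "a \<in> carrier R" "x \<in> carrier M"
  shows "a \<odot>\<^bsub>quotient_space M N\<^esub> (N +>\<^bsub>M\<^esub> x) = N +>\<^bsub>M\<^esub> (a \<odot>\<^bsub>M\<^esub> x)"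
proof -
  have "N +>\<^bsub>M\<^esub> (a \<odot>\<^bsub>M\<^esub> y) = N +>\<^bsub>M\<^esub> (a \<odot>\<^bsub>M\<^esub> x)" if "y \<in> N +>\<^bsub>M\<^esub> x" for y
  proof -
    from that obtain z where z: "z \<in> N" "y = z \<oplus>\<^bsub>M\<^esub> x"
      by (auto simp: a_r_coset_def')
    then have "a \<odot>\<^bsub>M\<^esub> y = a \<odot>\<^bsub>M\<^esub> z \<oplus>\<^bsub>M\<^esub> a \<odot>\<^bsub>M\<^esub> x"
      using assms N.subset by (auto simp: smult_r_distr)
    then have "a \<odot>\<^bsub>M\<^esub> y \<in> N +>\<^bsub>M\<^esub> (a \<odot>\<^bsub>M\<^esub> x)"
      using assms z by (auto simp: a_r_coset_def')
    then show ?thesis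
      using assms NA.a_repr_independence'[of "a \<odot>\<^bsub>M\<^esub> y" "a \<odot>\<^bsub>M\<^esub> x"] by auto
  qed
  moreover have "x \<in> N +>\<^bsub>M\<^esub> x"
    using assms NA.a_rcos_self by blast
  ultimately have "(\<Union>y\<in>N +>\<^bsub>M\<^esub> x. N +>\<^bsub>M\<^esub> (a \<odot>\<^bsub>M\<^esub> y)) = N +>\<^bsub>M\<^esub> (a \<odot>\<^bsub>M\<^esub> x)"
    by (intro SUP_eq_const) blast+
  then show ?thesis
    by (simp add: quotient_space_def)
qed

lemma coset_add:
  assumes "x \<in> carrier M" "y \<in> carrier M"
  shows "(N +>\<^bsub>M\<^esub> x) \<oplus>\<^bsub>quotient_space M N\<^esub> (N +>\<^bsub>M\<^esub> y) = N +>\<^bsub>M\<^esub> (x \<oplus>\<^bsub>M\<^esub> y)"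
  using assms by (simp add: quotient_space_def NA.a_rcos_sum)

lemma carrier_quotient_space: "carrier (quotient_space M N) = (\<lambda>x. N +>\<^bsub>M\<^esub> x) ` carrier M"
  by (auto simp: quotient_space_def A_RCOSETS_def')

lemma zero_quotient_space: "\<zero>\<^bsub>quotient_space M N\<^esub> = N +>\<^bsub>M\<^esub> \<zero>\<^bsub>M\<^esub>"
  using N.subset by (simp add: quotient_space_def)

lemma quotient_space_module: "module R (quotient_space M N)"
proof -
  let ?Q = "quotient_space M N"
  have rep: "\<exists>x\<in>carrier M. X = N +>\<^bsub>M\<^esub> x" if "X \<in> carrier ?Q" for X
    using that by (auto simp: carrier_quotient_space)
  have closed: "N +>\<^bsub>M\<^esub> x \<in> carrier ?Q" if "x \<in> carrier M" for x
    using that by (simp add: carrier_quotient_space)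
  show ?thesis
  proof (intro moduleI abelian_groupI R.is_cring)
    show "\<zero>\<^bsub>?Q\<^esub> \<in> carrier ?Q"
      by (simp add: zero_quotient_space closed)
  next
    fix X
    assume "X \<in> carrier ?Q"
    then obtain x where x [simp]: "x \<in> carrier M" "X = N +>\<^bsub>M\<^esub> x"
      using rep by blast
    show "\<zero>\<^bsub>?Q\<^esub> \<oplus>\<^bsub>?Q\<^esub> X = X" "\<one> \<odot>\<^bsub>?Q\<^esub> X = X"
      by (simp_all add: zero_quotient_space coset_add coset_smult)
    show "\<exists>Y\<in>carrier ?Q. Y \<oplus>\<^bsub>?Q\<^esub> X = \<zero>\<^bsub>?Q\<^esub>"
      by (intro bexI[of _ "N +>\<^bsub>M\<^esub> (\<ominus>\<^bsub>M\<^esub> x)"])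
        (simp_all add: zero_quotient_space coset_add M.l_neg closed)
    fix a
    assume a [simp]: "a \<in> carrier R"
    show "a \<odot>\<^bsub>?Q\<^esub> X \<in> carrier ?Q"
      by (simp add: coset_smult closed)
    show "(a \<oplus> b) \<odot>\<^bsub>?Q\<^esub> X = a \<odot>\<^bsub>?Q\<^esub> X \<oplus>\<^bsub>?Q\<^esub> b \<odot>\<^bsub>?Q\<^esub> X"
      "(a \<otimes> b) \<odot>\<^bsub>?Q\<^esub> X = a \<odot>\<^bsub>?Q\<^esub> (b \<odot>\<^bsub>?Q\<^esub> X)" if "b \<in> carrier R" for b
      using that by (simp_all add: coset_add coset_smult smult_l_distr smult_assoc1)
  next
    fix X Y
    assume "X \<in> carrier ?Q" "Y \<in> carrier ?Q"
    then obtain x y where [simp]: "x \<in> carrier M" "X = N +>\<^bsub>M\<^esub> x" "y \<in> carrier M" "Y = N +>\<^bsub>M\<^esub> y"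
      using rep by blast
    show "X \<oplus>\<^bsub>?Q\<^esub> Y \<in> carrier ?Q"
      by (simp add: coset_add closed)
    show "X \<oplus>\<^bsub>?Q\<^esub> Y = Y \<oplus>\<^bsub>?Q\<^esub> X"
      by (simp add: coset_add M.a_comm)
    show "a \<odot>\<^bsub>?Q\<^esub> (X \<oplus>\<^bsub>?Q\<^esub> Y) = a \<odot>\<^bsub>?Q\<^esub> X \<oplus>\<^bsub>?Q\<^esub> a \<odot>\<^bsub>?Q\<^esub> Y" if "a \<in> carrier R" for a
      using that by (simp add: coset_add coset_smult smult_r_distr)
    show "X \<oplus>\<^bsub>?Q\<^esub> Y \<oplus>\<^bsub>?Q\<^esub> Z = X \<oplus>\<^bsub>?Q\<^esub> (Y \<oplus>\<^bsub>?Q\<^esub> Z)" if "Z \<in> carrier ?Q" for Z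
      using rep[OF that] by (auto simp: coset_add M.a_assoc)
  qed
qed

lemma coset_eqI:
  assumes "x \<in> carrier M" "y \<in> carrier M" "x \<ominus>\<^bsub>M\<^esub> y \<in> N"
  shows "N +>\<^bsub>M\<^esub> x = N +>\<^bsub>M\<^esub> y"
proof (rule sym, rule NA.a_repr_independence')
  show "x \<in> N +>\<^bsub>M\<^esub> y"
    using assms by (intro NA.a_rcos_module_rev) (simp_all add: a_minus_def)
qed (rule assms)

text \<open>
  The homomorphism theorem in the form needed for \<open>tensor_lift\<close>, which takes the unique element of
  the image of a coset.
\<close>

lemma image_coset:
  assumes "h \<in> module_hom R M P" "module R P" "\<And>x. x \<in> N \<Longrightarrow> h x = \<zero>\<^bsub>P\<^esub>" "x \<in> carrier M"
  shows "h ` (N +>\<^bsub>M\<^esub> x) = {h x}"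
proof -
  interpret P: Module.module R P
    by (rule assms)
  have "h y = h x" if "y \<in> N +>\<^bsub>M\<^esub> x" for y
  proof -
    from that obtain z where z: "z \<in> N" "y = z \<oplus>\<^bsub>M\<^esub> x"
      by (auto simp: a_r_coset_def')
    then have "h y = h z \<oplus>\<^bsub>P\<^esub> h x"
      using assms(4) N.subset by (simp add: LinearCombinations.module_hom_add[OF assms(1)] subset_iff)
    with z show ?thesis
      using module_hom_in_carrier[OF assms(1,4)] by (simp add: assms(3))
  qed
  moreover have "x \<in> N +>\<^bsub>M\<^esub> x"
    using assms(4) by (rule NA.a_rcos_self)
  ultimately show ?thesis
    by blast
qed

end

end

section \<open>Tensor products\<close>

definition bilinear_map where
  "bilinear_map K V W M \<phi> \<longleftrightarrow>
     (\<forall>w\<in>carrier W. (\<lambda>v. \<phi> v w) \<in> module_hom K V M) \<and>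
     (\<forall>v\<in>carrier V. \<phi> v \<in> module_hom K W M)"

lemma bilinear_mapI:
  assumes "\<And>w. w \<in> carrier W \<Longrightarrow> (\<lambda>v. \<phi> v w) \<in> module_hom K V M"
    and "\<And>v. v \<in> carrier V \<Longrightarrow> (\<lambda>w. \<phi> v w) \<in> module_hom K W M"
  shows "bilinear_map K V W M \<phi>"
  using assms by (simp add: bilinear_map_def)

lemma bilinear_map_left:
  "bilinear_map K V W M \<phi> \<Longrightarrow> w \<in> carrier W \<Longrightarrow> (\<lambda>v. \<phi> v w) \<in> module_hom K V M"
  by (simp add: bilinear_map_def)

lemma bilinear_map_right:
  "bilinear_map K V W M \<phi> \<Longrightarrow> v \<in> carrier V \<Longrightarrow> (\<lambda>w. \<phi> v w) \<in> module_hom K W M"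
  by (simp add: bilinear_map_def)

locale tensor_factors = V: Module.module K V + W: Module.module K W
  for K :: "('k, 'm) ring_scheme"
    and V :: "('k, 'v, 'n) module_scheme" and W :: "('k, 'w, 'o) module_scheme"
begin

abbreviation "F \<equiv> free_space K (carrier V \<times> carrier W)"
abbreviation "N \<equiv> tensor_null K V W"
abbreviation "T \<equiv> tensor_space K V W"
abbreviation "gen v w \<equiv> free_gen K (v, w)"

sublocale F: Module.module K F
  by (rule V.free_space_module)

lemma gen_closed: "v \<in> carrier V \<Longrightarrow> w \<in> carrier W \<Longrightarrow> gen v w \<in> carrier F"
  by (intro V.free_gen_closed) auto

lemma tensor_rels_subset: "tensor_rels K V W \<subseteq> carrier F"
proof
  fix x
  assume "x \<in> tensor_rels K V W"
  then show "x \<in> carrier F"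
    unfolding tensor_rels_def Let_def by (elim UnE CollectE exE conjE) (simp_all add: gen_closed)
qed

lemma tensor_null_submodule: "submodule K N F"
  unfolding tensor_null_def by (intro F.span_is_submodule tensor_rels_subset)

lemma tensor_rels_null: "x \<in> tensor_rels K V W \<Longrightarrow> x \<in> N"
  unfolding tensor_null_def using F.in_own_span[OF tensor_rels_subset] by auto

sublocale T: Module.module K T
  unfolding tensor_space_def by (rule F.quotient_space_module[OF tensor_null_submodule])

lemma carrier_tensor_space: "carrier T = (\<lambda>f. N +>\<^bsub>F\<^esub> f) ` carrier F"
  unfolding tensor_space_def by (rule F.carrier_quotient_space[OF tensor_null_submodule])

text \<open>
  The four families of relations say precisely that \<open>\<otimes>\<close> is additive and homogeneous in each factor.
\<close>

lemma pure_tensor_bilinear: "bilinear_map K V W T (pure_tensor K V W)"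
proof (intro bilinear_mapI module_homI)
  fix v w
  assume v: "v \<in> carrier V" and w: "w \<in> carrier W"
  show "pure_tensor K V W v w \<in> carrier T"
    using v w gen_closed by (auto simp: carrier_tensor_space pure_tensor_def)
  then show "pure_tensor K V W v w \<in> carrier T" .
  note coset = pure_tensor_def tensor_space_def
    F.coset_add[OF tensor_null_submodule] F.coset_smult[OF tensor_null_submodule]
  show "pure_tensor K V W (v \<oplus>\<^bsub>V\<^esub> v') w = pure_tensor K V W v w \<oplus>\<^bsub>T\<^esub> pure_tensor K V W v' w"
    if v': "v' \<in> carrier V" for v'
    using v w v' gen_closed
    by (simp add: coset, intro F.coset_eqI[OF tensor_null_submodule] tensor_rels_null)
      (auto simp: tensor_rels_def Let_def)
  show "pure_tensor K V W v (w \<oplus>\<^bsub>W\<^esub> w') = pure_tensor K V W v w \<oplus>\<^bsub>T\<^esub> pure_tensor K V W v w'"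
    if w': "w' \<in> carrier W" for w'
    using v w w' gen_closed
    by (simp add: coset, intro F.coset_eqI[OF tensor_null_submodule] tensor_rels_null)
      (auto simp: tensor_rels_def Let_def)
  fix a
  assume a: "a \<in> carrier K"
  show "pure_tensor K V W (a \<odot>\<^bsub>V\<^esub> v) w = a \<odot>\<^bsub>T\<^esub> pure_tensor K V W v w"
    using v w a gen_closed
    by (simp add: coset, intro F.coset_eqI[OF tensor_null_submodule] tensor_rels_null)
      (auto simp: tensor_rels_def Let_def)
  show "pure_tensor K V W v (a \<odot>\<^bsub>W\<^esub> w) = a \<odot>\<^bsub>T\<^esub> pure_tensor K V W v w"
    using v w a gen_closed
    by (simp add: coset, intro F.coset_eqI[OF tensor_null_submodule] tensor_rels_null)
      (auto simp: tensor_rels_def Let_def)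
qed

lemmas pure_tensor_left = bilinear_map_left[OF pure_tensor_bilinear]
lemmas pure_tensor_right = bilinear_map_right[OF pure_tensor_bilinear]

lemma pure_tensor_closed:
  "v \<in> carrier V \<Longrightarrow> w \<in> carrier W \<Longrightarrow> pure_tensor K V W v w \<in> carrier T"
  using module_hom_in_carrier[OF pure_tensor_left] .

context
  fixes M :: "('k, 'c, 'p) module_scheme" and \<phi> :: "'v \<Rightarrow> 'w \<Rightarrow> 'c"
  assumes M: "Module.module K M" and \<phi>: "bilinear_map K V W M \<phi>"
begin

interpretation M: Module.module K M
  by (rule M)

lemma bilinear_closed: "v \<in> carrier V \<Longrightarrow> w \<in> carrier W \<Longrightarrow> \<phi> v w \<in> carrier M"
  using module_hom_in_carrier[OF bilinear_map_left[OF \<phi>]] .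

lemma lin_extend_bilinear_hom: "lin_extend K M (\<lambda>(v, w). \<phi> v w) \<in> module_hom K F M"
  by (rule M.lin_extend_hom) (auto intro: bilinear_closed)

lemma lin_extend_bilinear_gen:
  "v \<in> carrier V \<Longrightarrow> w \<in> carrier W \<Longrightarrow> lin_extend K M (\<lambda>(v, w). \<phi> v w) (gen v w) = \<phi> v w"
  by (simp add: M.lin_extend_gen bilinear_closed)

text \<open>
  Bilinearity makes the linear extension vanish on each defining relation; its kernel is a submodule
  and therefore contains their span.
\<close>

lemma lin_extend_tensor_null:
  assumes "x \<in> N"
  shows "lin_extend K M (\<lambda>(v, w). \<phi> v w) x = \<zero>\<^bsub>M\<^esub>"
proof -
  let ?h = "lin_extend K M (\<lambda>(v, w). \<phi> v w)"
  interpret h: mod_hom K F M ?h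
    using lin_extend_bilinear_hom by unfold_locales
  note left = LinearCombinations.module_hom_add[OF bilinear_map_left[OF \<phi>]] module_hom_smult[OF bilinear_map_left[OF \<phi>]]
  note right = LinearCombinations.module_hom_add[OF bilinear_map_right[OF \<phi>]] module_hom_smult[OF bilinear_map_right[OF \<phi>]]
  have "?h y = \<zero>\<^bsub>M\<^esub>" if "y \<in> tensor_rels K V W" for y
    using that unfolding tensor_rels_def Let_def
    by (auto simp: lin_extend_bilinear_gen gen_closed left right bilinear_closed)
  then have "tensor_rels K V W \<subseteq> h.ker"
    using tensor_rels_subset by (auto simp: h.ker_def)
  then have "N \<subseteq> h.ker"
    unfolding tensor_null_def by (rule F.span_is_subset) (rule h.ker_is_submodule)
  with assms show ?thesis
    by (auto simp: h.ker_def)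
qed

lemma tensor_lift_coset:
  assumes "f \<in> carrier F"
  shows "tensor_lift K M \<phi> (N +>\<^bsub>F\<^esub> f) = lin_extend K M (\<lambda>(v, w). \<phi> v w) f"
  unfolding tensor_lift_def
  by (simp add: F.image_coset[OF tensor_null_submodule lin_extend_bilinear_hom M
        lin_extend_tensor_null assms])

lemma tensor_lift_hom: "tensor_lift K M \<phi> \<in> module_hom K T M"
proof (rule module_homI)
  note h = lin_extend_bilinear_hom
  note coset = F.coset_add[OF tensor_null_submodule, folded tensor_space_def]
    F.coset_smult[OF tensor_null_submodule, folded tensor_space_def]
  fix x
  assume "x \<in> carrier T"
  then obtain f where f: "f \<in> carrier F" "x = N +>\<^bsub>F\<^esub> f"
    by (auto simp: carrier_tensor_space)
  then show "tensor_lift K M \<phi> x \<in> carrier M"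
    using module_hom_in_carrier[OF h] by (simp add: tensor_lift_coset)
  show "tensor_lift K M \<phi> (a \<odot>\<^bsub>T\<^esub> x) = a \<odot>\<^bsub>M\<^esub> tensor_lift K M \<phi> x" if "a \<in> carrier K" for a
    using f that by (simp add: coset tensor_lift_coset module_hom_smult[OF h])
  fix y
  assume "y \<in> carrier T"
  then obtain g where g: "g \<in> carrier F" "y = N +>\<^bsub>F\<^esub> g"
    by (auto simp: carrier_tensor_space)
  show "tensor_lift K M \<phi> (x \<oplus>\<^bsub>T\<^esub> y) = tensor_lift K M \<phi> x \<oplus>\<^bsub>M\<^esub> tensor_lift K M \<phi> y"
    using f g by (simp add: coset tensor_lift_coset LinearCombinations.module_hom_add[OF h])
qed

lemma tensor_lift_pure:
  "v \<in> carrier V \<Longrightarrow> w \<in> carrier W \<Longrightarrow> tensor_lift K M \<phi> (pure_tensor K V W v w) = \<phi> v w"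
  unfolding pure_tensor_def by (simp add: tensor_lift_coset gen_closed lin_extend_bilinear_gen)

end

lemma tensor_map_pure:
  assumes "tensor_factors K V' W'" "f \<in> module_hom K V V'" "g \<in> module_hom K W W'"
    and "v \<in> carrier V" "w \<in> carrier W"
  shows "tensor_map K V' W' f g (pure_tensor K V W v w) = pure_tensor K V' W' (f v) (g w)"
proof -
  interpret P: tensor_factors K V' W'
    by (rule assms)
  have "bilinear_map K V W P.T (\<lambda>v w. pure_tensor K V' W' (f v) (g w))"
    by (rule bilinear_mapI)
      (erule module_hom_comp[OF assms(2) P.pure_tensor_left[OF module_hom_in_carrier[OF assms(3)]]],
       erule module_hom_comp[OF assms(3) P.pure_tensor_right[OF module_hom_in_carrier[OF assms(2)]]])
  from tensor_lift_pure[OF P.T.module_axioms this assms(4,5)] show ?thesis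
    by (simp add: tensor_map_def)
qed

end

text \<open>
  If the values prescribed on the generators depend linearly on a parameter, then so does the value of
  the extension at any fixed element.  The associator is a lift of a family of lifts, and this gives
  linearity in the parameter \<open>w\<close> of that family.
\<close>

lemma (in Module.module) lin_extend_parameter_hom:
  assumes "Module.module R W" "f \<in> carrier (free_space R S)"
    and \<psi>: "\<And>s. s \<in> S \<Longrightarrow> (\<lambda>w. \<psi> w s) \<in> module_hom R W M"
  shows "(\<lambda>w. lin_extend R M (\<psi> w) f) \<in> module_hom R W M"
proof (rule module_homI)
  interpret W: Module.module R W
    by (rule assms)
  let ?A = "{x. f x \<noteq> \<zero>}"
  have A: "finite ?A" "?A \<subseteq> S"
    and f: "\<And>x. f x \<in> carrier R"
    using assms(2) by (auto simp: free_space_simps image_subset_iff)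
  have closed: "\<psi> w x \<in> carrier M" if "x \<in> ?A" "w \<in> carrier W" for w x
    using that A module_hom_in_carrier[OF \<psi>] by blast
  fix w
  assume w: "w \<in> carrier W"
  show "lin_extend R M (\<psi> w) f \<in> carrier M"
    unfolding lin_extend_def using f closed w by (intro M.finsum_closed) auto
  show "lin_extend R M (\<psi> (a \<odot>\<^bsub>W\<^esub> w)) f = a \<odot>\<^bsub>M\<^esub> lin_extend R M (\<psi> w) f" if a: "a \<in> carrier R" for a
  proof -
    have "\<psi> (a \<odot>\<^bsub>W\<^esub> w) x = a \<odot>\<^bsub>M\<^esub> \<psi> w x" if "x \<in> ?A" for x
      using that A a w module_hom_smult[OF \<psi>] by blast
    then have "lin_extend R M (\<psi> (a \<odot>\<^bsub>W\<^esub> w)) f = (\<Oplus>\<^bsub>M\<^esub>x\<in>?A. a \<odot>\<^bsub>M\<^esub> (f x \<odot>\<^bsub>M\<^esub> \<psi> w x))"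
      unfolding lin_extend_def using a f w closed
      by (intro M.finsum_cong') (auto simp: R.m_comm simp flip: smult_assoc1)
    also have "\<dots> = a \<odot>\<^bsub>M\<^esub> lin_extend R M (\<psi> w) f"
      unfolding lin_extend_def using a f w closed by (subst finsum_smult) auto
    finally show ?thesis .
  qed
  fix w'
  assume w': "w' \<in> carrier W"
  have "\<psi> (w \<oplus>\<^bsub>W\<^esub> w') x = \<psi> w x \<oplus>\<^bsub>M\<^esub> \<psi> w' x" if "x \<in> ?A" for x
    using that A w w' LinearCombinations.module_hom_add[OF \<psi>] by blast
  then have "lin_extend R M (\<psi> (w \<oplus>\<^bsub>W\<^esub> w')) f
      = (\<Oplus>\<^bsub>M\<^esub>x\<in>?A. f x \<odot>\<^bsub>M\<^esub> \<psi> w x \<oplus>\<^bsub>M\<^esub> f x \<odot>\<^bsub>M\<^esub> \<psi> w' x)"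
    unfolding lin_extend_def using f w w' closed
    by (intro M.finsum_cong') (auto simp: smult_r_distr)
  also have "\<dots> = lin_extend R M (\<psi> w) f \<oplus>\<^bsub>M\<^esub> lin_extend R M (\<psi> w') f"
    unfolding lin_extend_def using f w w' closed by (intro M.finsum_addf) auto
  finally show "lin_extend R M (\<psi> (w \<oplus>\<^bsub>W\<^esub> w')) f
      = lin_extend R M (\<psi> w) f \<oplus>\<^bsub>M\<^esub> lin_extend R M (\<psi> w') f" .
qed

text \<open>
  The associator is a lift of \<open>(t, w) \<mapsto> q t w\<close>, where \<open>q t w\<close> is itself the value at \<open>t\<close> of the lift of
  \<open>(u, v) \<mapsto> u \<otimes> (v \<otimes> w)\<close>.  Once \<open>q\<close> is known to be bilinear, two evaluations on pure tensors give
  the result.  Linearity in \<open>t\<close> holds for any lift; linearity in \<open>w\<close> has to be checked at elements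
  \<open>t\<close> that need not be pure, which is done on a representative \<open>f\<close> in the free module.
\<close>

lemma tensor_assoc_pure:
  assumes "Module.module K U" "Module.module K V" "Module.module K W"
    and u: "u \<in> carrier U" and v: "v \<in> carrier V" and w: "w \<in> carrier W"
  shows "tensor_assoc K U V W (pure_tensor K (tensor_space K U V) W (pure_tensor K U V u v) w)
    = pure_tensor K U (tensor_space K V W) u (pure_tensor K V W v w)"
proof -
  interpret UV: tensor_factors K U V
    by (intro tensor_factors.intro assms)
  interpret VW: tensor_factors K V W
    by (intro tensor_factors.intro assms)
  interpret L: tensor_factors K UV.T W
    by (intro tensor_factors.intro assms UV.T.module_axioms)
  interpret R: tensor_factors K U VW.T
    by (intro tensor_factors.intro assms VW.T.module_axioms)
  let ?p = "\<lambda>w u v. pure_tensor K U VW.T u (pure_tensor K V W v w)"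
  let ?q = "\<lambda>t w. tensor_lift K R.T (?p w) t"
  have p: "bilinear_map K U V R.T (?p w)" if "w \<in> carrier W" for w
    using that
    by (intro bilinear_mapI R.pure_tensor_left VW.pure_tensor_closed
        module_hom_comp[OF VW.pure_tensor_left R.pure_tensor_right])
  have "bilinear_map K UV.T W R.T ?q"
  proof (rule bilinear_mapI)
    show "(\<lambda>t. ?q t w) \<in> module_hom K UV.T R.T" if "w \<in> carrier W" for w
      using UV.tensor_lift_hom[OF R.T.module_axioms p[OF that]] .
    show "?q t \<in> module_hom K W R.T" if "t \<in> carrier UV.T" for t
    proof -
      from that obtain f where f: "f \<in> carrier UV.F" "t = UV.N +>\<^bsub>UV.F\<^esub> f"
        by (auto simp: UV.carrier_tensor_space)
      have "(\<lambda>w. lin_extend K R.T (\<lambda>(u, v). ?p w u v) f) \<in> module_hom K W R.T"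
      proof (rule R.T.lin_extend_parameter_hom[OF assms(3) f(1)])
        show "(\<lambda>w. case s of (u, v) \<Rightarrow> ?p w u v) \<in> module_hom K W R.T"
          if "s \<in> carrier U \<times> carrier V" for s
          using that by (auto intro!: module_hom_comp[OF VW.pure_tensor_right R.pure_tensor_right])
      qed
      moreover have "?q t w = lin_extend K R.T (\<lambda>(u, v). ?p w u v) f" if "w \<in> carrier W" for w
        using UV.tensor_lift_coset[OF R.T.module_axioms p[OF that] f(1)] f(2) by simp
      ultimately show ?thesis
        using VW.W.module_axioms by (auto simp: module_hom_def Module.module_def abelian_group_def
            abelian_monoid.a_closed VW.W.smult_closed)
    qed
  qed
  then show ?thesis
    using u v w UV.pure_tensor_closed L.tensor_lift_pure[OF R.T.module_axioms]
      UV.tensor_lift_pure[OF R.T.module_axioms p]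
    by (simp add: tensor_assoc_def Let_def)
qed

section \<open>Co-dialgebras from a distinguished vector\<close>

text \<open>
  Both maps are linear because \<open>\<otimes>\<close> is bilinear, and every induced map that occurs in an axiom is
  evaluated on a pure tensor only.  The two formulas are required on the carrier alone: an extension by \<open>lin_extend\<close> is controlled only there.
\<close>

theorem codialgebra_of_vector:
  assumes V: "vectorspace K V" and s: "s \<in> carrier V"
    and \<Delta>: "\<And>x. x \<in> carrier V \<Longrightarrow> \<Delta> x = pure_tensor K V V x s"
    and \<Delta>': "\<And>x. x \<in> carrier V \<Longrightarrow> \<Delta>' x = pure_tensor K V V s x"
  shows "coassociative_codialgebra K V \<Delta> \<Delta>'"
proof -
  interpret V: vectorspace K V
    by (rule V)
  have mV: "Module.module K V"
    by (rule V.module_axioms)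
  interpret VV: tensor_factors K V V
    by (intro tensor_factors.intro mV)
  have P: "tensor_factors K VV.T V" "tensor_factors K V VV.T"
    by (intro tensor_factors.intro mV VV.T.module_axioms)+
  have cong: "f \<in> module_hom K V VV.T"
    if "g \<in> module_hom K V VV.T" "\<And>x. x \<in> carrier V \<Longrightarrow> f x = g x" for f g
    using that by (auto simp: module_hom_def)
  have hom: "\<Delta> \<in> module_hom K V VV.T" "\<Delta>' \<in> module_hom K V VV.T"
    using cong[OF VV.pure_tensor_left[OF s]] cong[OF VV.pure_tensor_right[OF s]] \<Delta> \<Delta>' by auto
  have T: "vectorspace K VV.T"
    using VV.T.module_axioms V.field_axioms by (simp add: vectorspace_def)
  have lin: "linear_map K V VV.T f" if "f \<in> module_hom K V VV.T" for f
    using that V T mV VV.T.module_axioms by (simp add: linear_map_def mod_hom_def mod_hom_axioms_def)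
  \<comment> \<open>With these rules the simplifier brings both sides of every axiom to the same pure tensor.\<close>
  note left = VV.tensor_map_pure[OF P(1) _ module_hom_id, folded tensor_left_def]
  note right = VV.tensor_map_pure[OF P(2) module_hom_id, folded tensor_right_def]
  note [simp] = left[OF hom(1)] left[OF hom(2)] right[OF hom(1)] right[OF hom(2)]
    \<Delta> \<Delta>' s tensor_assoc_pure[OF mV mV mV]
  show ?thesis
    by (intro coassociative_codialgebra.intro coassociative_codialgebra_axioms.intro V lin hom)
      (simp_all add: coassociative_def)
qed

text \<open>
  The sum over \<open>j\<close> in \<open>\<Delta>'\<close> is taken in \<open>V \<otimes> V\<close>; additivity of \<open>v \<mapsto> v \<otimes> v\<^sub>i\<close> moves it into the left
  factor, where it becomes \<open>s\<close>.
\<close>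

lemma de_bruijn_codialgebra:
  assumes K: "field K"
  shows "coassociative_codialgebra K (de_bruijn_space K n)
    (markov_coproduct K n) (markov_coproduct' K n)"
proof -
  interpret K: field K
    by (rule K)
  let ?V = "de_bruijn_space K n"
  have V_eq: "?V = free_space K {1..n}"
    by (simp add: de_bruijn_space_def de_bruijn_graph_def)
  have mV: "Module.module K ?V"
    unfolding V_eq by (rule K.free_space_module)
  interpret V: Module.module K ?V
    by (rule mV)
  interpret VV: tensor_factors K ?V ?V
    by (intro tensor_factors.intro mV)
  define s where "s = (\<Oplus>\<^bsub>?V\<^esub>j\<in>{1..n}. free_gen K j)"
  have gen: "free_gen K j \<in> carrier ?V" if "j \<in> {1..n}" for j
    unfolding V_eq using that by (rule K.free_gen_closed)
  then have s: "s \<in> carrier ?V"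
    unfolding s_def by (intro V.M.finsum_closed) auto
  have agree: "lin_extend K VV.T \<phi> x = h x"
    if x: "x \<in> carrier ?V" and h: "h \<in> module_hom K ?V VV.T"
      and \<phi>_gen: "\<And>i. i \<in> {1..n} \<Longrightarrow> \<phi> i = h (free_gen K i)" for \<phi> h x
  proof (rule VV.T.free_space_hom_eqI[of "lin_extend K VV.T \<phi>" "{1..n}" h x])
    have \<phi>: "\<phi> i \<in> carrier VV.T" if "i \<in> {1..n}" for i
      using \<phi>_gen[OF that] module_hom_in_carrier[OF h gen[OF that]] by simp
    then show "lin_extend K VV.T \<phi> \<in> module_hom K (free_space K {1..n}) VV.T"
      by (intro VV.T.lin_extend_hom) auto
    show "lin_extend K VV.T \<phi> (free_gen K i) = h (free_gen K i)" if "i \<in> {1..n}" for i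
      using VV.T.lin_extend_gen[of \<phi> i] \<phi>[OF that] \<phi>_gen[OF that] by simp
    show "h \<in> module_hom K (free_space K {1..n}) VV.T"
      using h unfolding V_eq .
    show "x \<in> carrier (free_space K {1..n})"
      using x unfolding V_eq .
  qed
  show ?thesis
  proof (rule codialgebra_of_vector)
    show "vectorspace K ?V"
      using mV K by (simp add: vectorspace_def)
    show "s \<in> carrier ?V"
      by (rule s)
    fix x
    assume x: "x \<in> carrier ?V"
    show "markov_coproduct K n x = pure_tensor K ?V ?V x s"
      unfolding markov_coproduct_def Let_def
      using agree[OF x VV.pure_tensor_left[OF s]] by (simp add: s_def)
    have "(\<Oplus>\<^bsub>VV.T\<^esub>j\<in>{1..n}. pure_tensor K ?V ?V (free_gen K j) (free_gen K i))
        = pure_tensor K ?V ?V s (free_gen K i)" if "i \<in> {1..n}" for i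
      unfolding s_def using gen that
      by (intro module_hom_finsum[OF mV VV.T.module_axioms VV.pure_tensor_left, symmetric]) auto
    then show "markov_coproduct' K n x = pure_tensor K ?V ?V s x"
      unfolding markov_coproduct'_def Let_def
      by (intro agree[OF x VV.pure_tensor_right[OF s]])
  qed
qed

theorem proposition2p9:
  fixes n :: nat
  assumes "n \<ge> 1"
  shows "coassociative_codialgebra (class_ring :: real ring) (de_bruijn_space class_ring n)
           (markov_coproduct class_ring n) (markov_coproduct' class_ring n)
       \<and> coassociative_codialgebra (class_ring :: complex ring) (de_bruijn_space class_ring n)
           (markov_coproduct class_ring n) (markov_coproduct' class_ring n)"
  by (intro conjI de_bruijn_codialgebra class_field)

end
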